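(* Let $P\in\mathcal{P}(\mathbb{R}^d)$ and let $\Phi$ be an admissible test class on $\mathbb{R}^d$ (as defined in the context), with associated integral probability metric $\mathrm{D}_\Phi$. (a) Assume $\mu\in\mathcal{P}^1(\mathbb{R}^d)$ satisfies the bias potential model: there is $V^*\in\Phi$ with $$\int_{\mathbb{R}^d}e^{-V^*(x)}\mathrm{d}P(x)<+\infty,\qquad\frac{\mathrm{d}\mu}{\mathrm{d}P}=\frac{e^{-V^*}}{\int_{\mathbb{R}^d}e^{-V^*(x)}\mathrm{d}P(x)}.$$ Let $\nu\in\mathcal{P}^1(\mathbb{R}^d)$ and, for $V\in\Phi$, define $$\mathrm{Loss}_1(V)=\int_{\mathbb{R}^d}V(x)\,\mathrm{d}\nu(x)+\log\left(\int_{\mathbb{R}^d}e^{-V(x)}\mathrm{d}P(x)\right)\in(-\infty,+\infty].$$ Let $V'\in\Phi$ and $\mu'\in\mathcal{P}(\mathbb{R}^d)$ satisfy $$\int_{\mathbb{R}^d}e^{-V'(x)}\mathrm{d}P(x)<+\infty,\qquad\frac{\mathrm{d}\mu'}{\mathrm{d}P}=\frac{e^{-V'}}{\int_{\mathbb{R}^d}e^{-V'(x)}\mathrm{d}P(x)}.$$ Then $\inf_{V\in\Phi}\mathrm{Loss}_1(V)>-\infty$ and $$\mathcal{H}(\mu|\mu')\le2\,\mathrm{D}_\Phi(\mu,\nu)+\mathrm{Loss}_1(V')-\inf_{V\in\Phi}\mathrm{Loss}_1(V).$$ If in addition $P$ has compact support and $K=\max\{\|x-y\|:x,y\in\mathrm{supp}(P)\}<+\infty$,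 then $$\mathcal{W}_1^2(\mu,\mu')\le\frac{K^2}{2}\left[2\,\mathrm{D}_\Phi(\mu,\nu)+\mathrm{Loss}_1(V')-\inf_{V\in\Phi}\mathrm{Loss}_1(V)\right].$$ (b) Assume $\mu\in\mathcal{P}^1(\mathbb{R}^d)$ satisfies the density model: there is $q^*\in\Phi$ with $q^*=\frac{\mathrm{d}\mu}{\mathrm{d}P}$. Let $\nu\in\mathcal{P}^1(\mathbb{R}^d)$ and, for $q\in\Phi$, define $$\mathrm{Loss}_2(q)=\sup_{f\in\Phi}\left|\int_{\mathbb{R}^d}f\,\mathrm{d}\nu-\int_{\mathbb{R}^d}fq\,\mathrm{d}P\right|$$ (with the convention $\mathrm{Loss}_2(q)=+\infty$ if $fq$ is not $P$-integrable for some $f\in\Phi$). Let $q'\in\Phi$ and $\mu'\in\mathcal{P}(\mathbb{R}^d)$ satisfy $q'=\frac{\mathrm{d}\mu'}{\mathrm{d}P}$. Then $$\inf_{q\in\Phi}\mathrm{Loss}_2(q)\le\mathrm{D}_\Phi(\mu,\nu),\qquad\|\mu-\mu'\|_{TV}^2\le2\left[\mathrm{D}_\Phi(\mu,\nu)+\mathrm{Loss}_2(q')\right].$$ If in addition $P$ has compact support and $K=\max\{\|x-y\|:x,y\in\mathrm{supp}(P)\}<+\infty$, then $$\mathcal{W}_1^2(\mu,\mu')\le2K^2\left[\mathrm{D}_\Phi(\mu,\nu)+\mathrm{Loss}_2(q')\right].$$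
   Context: $\|\cdot\|$ is the Euclidean norm; $\mathrm{Lip}(f)=\sup_{x\ne y}|f(x)-f(y)|/\|x-y\|$. $\mathcal{P}(\mathbb{R}^d)$ is the set of Borel probability measures on $\mathbb{R}^d$, and $\mathcal{P}^1(\mathbb{R}^d)$ the subset of those with finite first moment. Admissible test class: a class $\Phi$ of functions $f:\mathbb{R}^d\to\mathbb{R}$ is an admissible test class with constants $A_1,A_2,A_3$ if (a) whenever $\mu$ is a finite signed Borel measure on $\mathbb{R}^d$ with $\int\|x\|\,\mathrm{d}|\mu|<\infty$ and $\int f\,\mathrm{d}\mu=0$ for all $f\in\Phi$, then $\mu=0$; (b) $A_1=\sup_{f\in\Phi}\mathrm{Lip}(f)<\infty$ and $A_2=\sup_{f\in\Phi}|f(0)|<\infty$; (c) $A_3>0$ and for every $n\ge1$ and all points $x^1,\dots,x^n\in\mathbb{R}^d$, $$\frac1n\mathbb{E}\sup_{f\in\Phi}\Bigl|\sum_{i=1}^n\xi_if(x^i)\Bigr|\le\frac{A_3}{n}\sqrt{\sum_{i=1}^n(\|x^i\|^2+1)},$$ where $\xi_1,\dots,\xi_n$ are i.i.d. with $\mathbb{P}(\xi_i=1)=\mathbb{P}(\xi_i=-1)=\frac12$. Integral probability metric: for $\mu,\mu'\in\mathcal{P}^1(\mathbb{R}^d)$, $\mathrm{D}_\Phi(\mu,\mu')=\sup_{f\in\Phi}\left|\int_{\mathbb{R}^d}f\,\mathrm{d}(\mu-\mu')\right|$. $\mathcal{W}_1$ is the 1-Wasserstein distance for the Euclidean norm. $\mathcal{H}(\mu|\mu')=\mathbb{E}^{\mu}[\log(\mathrm{d}\mu/\mathrm{d}\mu')]$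 is the relative entropy. $\|\mu-\mu'\|_{TV}=\sup_{A\text{ Borel}}|\mu(A)-\mu'(A)|$ is the total variation distance. *)

theory Defs
  imports "HOL-Probability.Probability"
begin

section \<open>Borel probability measures\<close>

definition prob_measures :: "'a::topological_space measure set" where
  "prob_measures = {\<mu>. prob_space \<mu> \<and> sets \<mu> = sets borel}"

definition prob_measures1 :: "'a::euclidean_space measure set" where
  "prob_measures1 = {\<mu> \<in> prob_measures. integrable \<mu> (\<lambda>x. norm x)}"

definition measure_support :: "'a::topological_space measure \<Rightarrow> 'a set" where
  "measure_support \<mu> = {x. \<forall>U. open U \<longrightarrow> x \<in> U \<longrightarrow> emeasure \<mu> U > 0}"

text \<open>A real-valued \<open>g\<close> is a version of the Radon--Nikodym derivative \<open>d\<mu>/dP\<close>. Nonnegativity has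
  to be demanded separately, because \<open>ennreal\<close> truncates negative values to 0.\<close>

definition is_RN_density :: "'a measure \<Rightarrow> 'a measure \<Rightarrow> ('a \<Rightarrow> real) \<Rightarrow> bool" where
  "is_RN_density P \<mu> g \<longleftrightarrow>
     g \<in> borel_measurable P \<and> (AE x in P. 0 \<le> g x) \<and> \<mu> = density P (\<lambda>x. ennreal (g x))"


section \<open>Finite signed Borel measures\<close>

text \<open>Only the values on Borel sets matter. The empty set gets measure 0, since a convergent
  constant series vanishes.\<close>

definition signed_borel_measure :: "('a::topological_space set \<Rightarrow> real) \<Rightarrow> bool" where
  "signed_borel_measure \<mu> \<longleftrightarrow>
     (\<forall>A :: nat \<Rightarrow> 'a set. range A \<subseteq> sets borel \<longrightarrow> disjoint_family A \<longrightarrow>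
        (\<lambda>i. \<mu> (A i)) sums \<mu> (\<Union>i. A i))"

text \<open>The positive part of the Jordan decomposition,
  \<open>\<mu>\<^sup>+(A) = sup {\<mu>(B) | B \<subseteq> A Borel}\<close>; the negative part is the positive part of \<open>-\<mu>\<close>.
  The lemma \<open>emeasure_jordan_pos\<close> shows that it really takes these values.\<close>

definition jordan_pos :: "('a::topological_space set \<Rightarrow> real) \<Rightarrow> 'a measure" where
  "jordan_pos \<mu> = measure_of UNIV (sets borel)
     (\<lambda>A. SUP B\<in>{B \<in> sets borel. B \<subseteq> A}. ennreal (\<mu> B))"

definition jordan_neg :: "('a::topological_space set \<Rightarrow> real) \<Rightarrow> 'a measure" where
  "jordan_neg \<mu> = jordan_pos (\<lambda>A. - \<mu> A)"

definition variation_measure :: "('a::topological_space set \<Rightarrow> real) \<Rightarrow> 'a measure" where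
  "variation_measure \<mu> = measure_of UNIV (sets borel)
     (\<lambda>A. emeasure (jordan_pos \<mu>) A + emeasure (jordan_neg \<mu>) A)"

definition signed_integral :: "('a::topological_space set \<Rightarrow> real) \<Rightarrow> ('a \<Rightarrow> real) \<Rightarrow> real" where
  "signed_integral \<mu> f = (\<integral>x. f x \<partial>jordan_pos \<mu>) - (\<integral>x. f x \<partial>jordan_neg \<mu>)"

lemma signed_borel_measure_empty:
  assumes "signed_borel_measure \<mu>"
  shows "\<mu> {} = 0"
proof -
  have "(\<lambda>i::nat. \<mu> {}) sums \<mu> (\<Union>i::nat. {})"
    using assms unfolding signed_borel_measure_def disjoint_family_on_def
    by (elim allE[of _ "\<lambda>_. {}"]) auto
  then have "summable (\<lambda>i::nat. \<mu> {})" by (rule sums_summable)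
  then show ?thesis by (simp only: summable_const_iff)
qed

lemma signed_borel_measure_Un:
  assumes "signed_borel_measure \<mu>" "A \<in> sets borel" "B \<in> sets borel" "A \<inter> B = {}"
  shows "\<mu> (A \<union> B) = \<mu> A + \<mu> B"
proof -
  have s: "(\<lambda>i. \<mu> (binaryset A B i)) sums \<mu> (\<Union>i. binaryset A B i)"
  proof -
    have "range (binaryset A B) \<subseteq> sets borel" using assms by (auto simp: range_binaryset_eq)
    moreover have "disjoint_family (binaryset A B)"
      using assms(4) by (auto simp: disjoint_family_on_def binaryset_def)
    ultimately show ?thesis using assms(1) unfolding signed_borel_measure_def by blast
  qed
  have "(\<lambda>i. \<mu> (binaryset A B i)) sums (\<mu> A + \<mu> B)"
    by (rule binaryset_sums) (rule signed_borel_measure_empty[OF assms(1)])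
  with s show ?thesis by (metis UN_binaryset_eq sums_unique2)
qed

lemma emeasure_jordan_pos:
  fixes \<mu> :: "'a::topological_space set \<Rightarrow> real"
  assumes \<mu>: "signed_borel_measure \<mu>" and A: "A \<in> sets borel"
  shows "emeasure (jordan_pos \<mu>) A = (SUP B\<in>{B \<in> sets borel. B \<subseteq> A}. ennreal (\<mu> B))"
proof -
  define U where "U A = (SUP B\<in>{B \<in> sets borel. B \<subseteq> A}. ennreal (\<mu> B))" for A
  have upper: "ennreal (\<mu> B) \<le> U A" if "B \<in> sets borel" "B \<subseteq> A" for A B
    unfolding U_def using that by (intro SUP_upper) auto
  have mono: "U A \<le> U B" if "A \<subseteq> B" for A B
    unfolding U_def using that by (intro SUP_subset_mono) auto
  have ne: "{B \<in> sets borel. B \<subseteq> A} \<noteq> {}" for A :: "'a set" by auto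
  have add2: "U A + U C \<le> U (A \<union> C)" if "A \<inter> C = {}" for A C
  proof -
    have bound: "ennreal (\<mu> B) + ennreal (\<mu> D) \<le> U (A \<union> C)"
      if B: "B \<in> sets borel" "B \<subseteq> A" and D: "D \<in> sets borel" "D \<subseteq> C" for B D
    proof (cases "\<mu> B \<le> 0 \<or> \<mu> D \<le> 0")
      case True
      moreover have "ennreal (\<mu> B) \<le> U (A \<union> C)" "ennreal (\<mu> D) \<le> U (A \<union> C)"
        using B D by (auto intro!: upper)
      ultimately show ?thesis by (auto simp: ennreal_neg)
    next
      case False
      have "\<mu> (B \<union> D) = \<mu> B + \<mu> D"
        using B D \<open>A \<inter> C = {}\<close> by (intro signed_borel_measure_Un[OF \<mu>]) auto
      then have "ennreal (\<mu> B) + ennreal (\<mu> D) = ennreal (\<mu> (B \<union> D))"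
        using False by (simp add: ennreal_plus)
      also have "\<dots> \<le> U (A \<union> C)" using B D by (intro upper) auto
      finally show ?thesis .
    qed
    have "U A + U C = (SUP B\<in>{B \<in> sets borel. B \<subseteq> A}. ennreal (\<mu> B) + U C)"
      unfolding U_def[of A] by (rule ennreal_SUP_add_left[symmetric]) (rule ne)
    also have "\<dots> \<le> U (A \<union> C)"
    proof (rule SUP_least)
      fix B assume B: "B \<in> {B \<in> sets borel. B \<subseteq> A}"
      have "ennreal (\<mu> B) + U C = (SUP D\<in>{D \<in> sets borel. D \<subseteq> C}. ennreal (\<mu> B) + ennreal (\<mu> D))"
        unfolding U_def[of C] by (rule ennreal_SUP_add_right) (rule ne)
      also have "\<dots> \<le> U (A \<union> C)" using B bound by (intro SUP_least) auto
      finally show "ennreal (\<mu> B) + U C \<le> U (A \<union> C)" .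
    qed
    finally show ?thesis .
  qed
  have empty: "U {} = 0"
  proof -
    have "{B \<in> sets (borel :: 'a measure). B \<subseteq> {}} = {{}}" by auto
    then show ?thesis unfolding U_def by (simp add: signed_borel_measure_empty[OF \<mu>])
  qed
  have "countably_additive (sets borel) U"
    unfolding countably_additive_def
  proof (intro allI impI antisym)
    fix A :: "nat \<Rightarrow> 'a set"
    assume A: "range A \<subseteq> sets borel" "disjoint_family A" "(\<Union>i. A i) \<in> sets borel"
    have fin: "(\<Sum>i<n. U (A i)) \<le> U (\<Union>i<n. A i)" for n
    proof (induction n)
      case (Suc n)
      have "(\<Sum>i<Suc n. U (A i)) \<le> U (\<Union>i<n. A i) + U (A n)"
        using Suc by (simp add: add_right_mono)
      also have "\<dots> \<le> U ((\<Union>i<n. A i) \<union> A n)"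
      proof (rule add2)
        have "A i \<inter> A n = {}" if "i < n" for i
          using A(2) that unfolding disjoint_family_on_def by simp
        then show "(\<Union>i<n. A i) \<inter> A n = {}" by blast
      qed
      also have "(\<Union>i<n. A i) \<union> A n = (\<Union>i<Suc n. A i)" by (auto simp: less_Suc_eq)
      finally show ?case .
    qed (simp add: empty)
    show "(\<Sum>i. U (A i)) \<le> U (\<Union>i. A i)"
      by (intro suminf_le_const summableI order_trans[OF fin] mono) auto
    show "U (\<Union>i. A i) \<le> (\<Sum>i. U (A i))"
      unfolding U_def[of "\<Union>i. A i"]
    proof (rule SUP_least)
      fix B assume B: "B \<in> {B \<in> sets borel. B \<subseteq> (\<Union>i. A i)}"
      have "(\<lambda>i. \<mu> (B \<inter> A i)) sums \<mu> (\<Union>i. B \<inter> A i)"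
      proof -
        have "range (\<lambda>i. B \<inter> A i) \<subseteq> sets borel" using A(1) B by auto
        moreover have "disjoint_family (\<lambda>i. B \<inter> A i)"
          using A(2) by (auto simp: disjoint_family_on_def)
        ultimately show ?thesis using \<mu> unfolding signed_borel_measure_def by blast
      qed
      moreover have "(\<Union>i. B \<inter> A i) = B" using B by auto
      ultimately have lim: "(\<lambda>n. ennreal (\<Sum>i<n. \<mu> (B \<inter> A i))) \<longlonglongrightarrow> ennreal (\<mu> B)"
        unfolding sums_def by (intro tendsto_ennrealI) simp
      show "ennreal (\<mu> B) \<le> (\<Sum>i. U (A i))"
      proof (rule LIMSEQ_le_const2[OF lim], intro exI allI impI)
        fix n :: nat
        have "ennreal (\<Sum>i<n. \<mu> (B \<inter> A i)) \<le> ennreal (\<Sum>i<n. max 0 (\<mu> (B \<inter> A i)))"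
          by (intro ennreal_leI sum_mono) auto
        also have "\<dots> = (\<Sum>i<n. ennreal (\<mu> (B \<inter> A i)))"
          by (subst sum_ennreal[symmetric]) auto
        also have "\<dots> \<le> (\<Sum>i<n. U (A i))"
          using A(1) B by (intro sum_mono upper) auto
        also have "\<dots> \<le> (\<Sum>i. U (A i))" by (intro sum_le_suminf summableI) auto
        finally show "ennreal (\<Sum>i<n. \<mu> (B \<inter> A i)) \<le> (\<Sum>i. U (A i))" .
      qed
    qed
  qed
  moreover have "sigma_algebra UNIV (sets (borel :: 'a measure))"
    using sets.sigma_algebra_axioms[of "borel :: 'a measure"] by simp
  ultimately have "emeasure (measure_of UNIV (sets borel) U) A = U A"
    using A empty by (intro emeasure_measure_of_sigma) (auto simp: positive_def)
  moreover have "jordan_pos \<mu> = measure_of UNIV (sets borel) U"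
    unfolding jordan_pos_def U_def ..
  ultimately show ?thesis by (simp add: U_def)
qed


section \<open>Admissible test classes\<close>

definition Lip :: "('a::euclidean_space \<Rightarrow> real) \<Rightarrow> ereal" where
  "Lip f = (SUP (x, y)\<in>{(x, y). x \<noteq> y}. ereal (\<bar>f x - f y\<bar> / norm (x - y)))"

text \<open>The law of \<open>n\<close> i.i.d. uniform signs \<open>\<xi>\<^sub>1, \<dots>, \<xi>\<^sub>n\<close>, as functions on \<open>{1..n}\<close>.\<close>

definition rademacher_signs :: "nat \<Rightarrow> (nat \<Rightarrow> real) pmf" where
  "rademacher_signs n = Pi_pmf {1..n} 0 (\<lambda>_. pmf_of_set {-1, 1})"

definition admissible_test_class ::
    "('a::euclidean_space \<Rightarrow> real) set \<Rightarrow> real \<Rightarrow> real \<Rightarrow> real \<Rightarrow> bool" where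
  "admissible_test_class \<Phi> A1 A2 A3 \<longleftrightarrow>
     (\<forall>\<mu>. signed_borel_measure \<mu> \<longrightarrow>
        (\<integral>\<^sup>+x. ennreal (norm x) \<partial>variation_measure \<mu>) < \<infinity> \<longrightarrow>
        (\<forall>f\<in>\<Phi>. signed_integral \<mu> f = 0) \<longrightarrow> (\<forall>A\<in>sets borel. \<mu> A = 0)) \<and>
     ereal A1 = (SUP f\<in>\<Phi>. Lip f) \<and>
     ereal A2 = (SUP f\<in>\<Phi>. ereal \<bar>f 0\<bar>) \<and>
     A3 > 0 \<and>
     (\<forall>n\<ge>1. \<forall>x :: nat \<Rightarrow> 'a.
        ennreal (1 / real n) *
          (\<integral>\<^sup>+\<xi>. (SUP f\<in>\<Phi>. ennreal \<bar>\<Sum>i=1..n. \<xi> i * f (x i)\<bar>) \<partial>measure_pmf (rademacher_signs n))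
        \<le> ennreal (A3 / real n * sqrt (\<Sum>i=1..n. ((norm (x i))\<^sup>2 + 1))))"


section \<open>Distances and relative entropy\<close>

definition ipm :: "('a \<Rightarrow> real) set \<Rightarrow> 'a measure \<Rightarrow> 'a measure \<Rightarrow> ereal" where
  "ipm \<Phi> \<mu> \<mu>' = (SUP f\<in>\<Phi>. ereal \<bar>(\<integral>x. f x \<partial>\<mu>) - (\<integral>x. f x \<partial>\<mu>')\<bar>)"

definition couplings :: "'a::topological_space measure \<Rightarrow> 'a measure \<Rightarrow> ('a \<times> 'a) measure set" where
  "couplings \<mu> \<mu>' = {\<pi>. sets \<pi> = sets (borel \<Otimes>\<^sub>M borel) \<and>
     distr \<pi> borel fst = \<mu> \<and> distr \<pi> borel snd = \<mu>'}"

definition wasserstein1 :: "'a::euclidean_space measure \<Rightarrow> 'a measure \<Rightarrow> ereal" where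
  "wasserstein1 \<mu> \<mu>' =
     (INF \<pi>\<in>couplings \<mu> \<mu>'. enn2ereal (\<integral>\<^sup>+(x, y). ennreal (norm (x - y)) \<partial>\<pi>))"

text \<open>\<open>KL_divergence b \<mu>' \<mu>\<close> takes the reference measure first, and is 0 by default when
  \<open>log (d\<mu>/d\<mu>')\<close> is not \<open>\<mu>\<close>-integrable. For probability measures the negative part of
  \<open>log (d\<mu>/d\<mu>')\<close> is always \<open>\<mu>\<close>-integrable, so the correct value is then \<open>\<infinity>\<close>.\<close>

definition relative_entropy :: "'a measure \<Rightarrow> 'a measure \<Rightarrow> ereal" where
  "relative_entropy \<mu> \<mu>' =
     (if absolutely_continuous \<mu>' \<mu> \<and> integrable \<mu> (entropy_density (exp 1) \<mu>' \<mu>)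
      then ereal (KL_divergence (exp 1) \<mu>' \<mu>) else \<infinity>)"

definition tv_dist :: "'a::topological_space measure \<Rightarrow> 'a measure \<Rightarrow> real" where
  "tv_dist \<mu> \<mu>' = (SUP A\<in>sets borel. \<bar>measure \<mu> A - measure \<mu>' A\<bar>)"


section \<open>Models and losses\<close>

definition has_bias_potential :: "'a measure \<Rightarrow> ('a \<Rightarrow> real) \<Rightarrow> 'a measure \<Rightarrow> bool" where
  "has_bias_potential P V \<mu> \<longleftrightarrow>
     integrable P (\<lambda>x. exp (- V x)) \<and>
     is_RN_density P \<mu> (\<lambda>x. exp (- V x) / (\<integral>y. exp (- V y) \<partial>P))"

text \<open>For measurable \<open>V\<close>, integrability of the nonnegative function \<open>exp (- V)\<close> fails exactly if its
  integral is \<open>\<infinity>\<close>. The other value is finite, as \<open>exp (- V) > 0\<close> and \<open>P\<close> is a probability.\<close>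

definition Loss1 :: "'a measure \<Rightarrow> 'a measure \<Rightarrow> ('a \<Rightarrow> real) \<Rightarrow> ereal" where
  "Loss1 P \<nu> V =
     (if integrable P (\<lambda>x. exp (- V x))
      then ereal ((\<integral>x. V x \<partial>\<nu>) + ln (\<integral>x. exp (- V x) \<partial>P)) else \<infinity>)"

definition Loss2 :: "'a measure \<Rightarrow> ('a \<Rightarrow> real) set \<Rightarrow> 'a measure \<Rightarrow> ('a \<Rightarrow> real) \<Rightarrow> ereal" where
  "Loss2 P \<Phi> \<nu> q =
     (if \<forall>f\<in>\<Phi>. integrable P (\<lambda>x. f x * q x)
      then SUP f\<in>\<Phi>. ereal \<bar>(\<integral>x. f x \<partial>\<nu>) - (\<integral>x. f x * q x \<partial>P)\<bar> else \<infinity>)"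

end

theory Submission
  imports Defs
begin

text \<open>
  The relative entropy of two bias potential models and the squared \<open>L\<^sup>2(P)\<close> distance of two
  densities in \<open>\<Phi>\<close> are integrals of test functions against \<open>\<mu>\<close> and \<open>\<mu>'\<close>; replacing \<open>\<mu>\<close> by \<open>\<nu>\<close>
  costs one \<open>D\<^sub>\<Phi>(\<mu>, \<nu>)\<close> per test function. In (a), \<open>H(\<mu>|\<mu>')\<close> is the difference of the losses of
  \<open>V'\<close> and \<open>V\<^sup>*\<close> with \<open>\<mu>\<close> in place of \<open>\<nu>\<close>. In (b),
  \<open>\<integral> (q\<^sup>* - q')\<^sup>2 dP = \<integral> (q\<^sup>* - q') d(\<mu> - \<mu>')\<close>, and the Cauchy--Schwarz inequality bounds the
  total variation distance. The Wasserstein bounds follow from Pinsker's inequality in (a) and from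
  \<open>W\<^sub>1 \<le> K TV\<close>, realised by the coupling that leaves the common part of \<open>\<mu>\<close> and \<open>\<mu>'\<close> at rest.
\<close>

lemma prob_measuresD:
  assumes "\<mu> \<in> prob_measures"
  shows "prob_space \<mu>" "sets \<mu> = sets borel" "space \<mu> = UNIV"
  using assms sets_eq_imp_space_eq[of \<mu> borel] by (auto simp: prob_measures_def)

lemma prob_measures1D:
  assumes "\<mu> \<in> prob_measures1"
  shows "\<mu> \<in> prob_measures" "integrable \<mu> norm"
  using assms by (auto simp: prob_measures1_def)

subsection \<open>Bounds for test functions\<close>

lemma admissible_lipschitz:
  assumes "admissible_test_class \<Phi> A1 A2 A3" "f \<in> \<Phi>"
  shows "A1-lipschitz_on UNIV f"
proof -
  have le: "\<bar>f x - f y\<bar> / norm (x - y) \<le> A1" if "x \<noteq> y" for x y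
  proof -
    have "ereal (\<bar>f x - f y\<bar> / norm (x - y)) \<le> Lip f"
      unfolding Lip_def using that by (intro SUP_upper2[of "(x, y)"]) auto
    also have "\<dots> \<le> (SUP f\<in>\<Phi>. Lip f)"
      using assms(2) by (rule SUP_upper)
    also have "\<dots> = ereal A1"
      using assms(1) by (simp add: admissible_test_class_def)
    finally show ?thesis by simp
  qed
  \<comment> \<open>A Lipschitz constant has to be nonnegative, and the sign of \<open>A1\<close>
    shows only on a pair of distinct points; a basis vector and 0 form one.\<close>
  obtain b :: 'a where "b \<in> Basis" using nonempty_Basis by blast
  then have "0 \<le> A1"
    using le[of b 0] nonzero_Basis[of b] by (auto intro: order_trans[OF abs_ge_zero])
  moreover have "dist (f x) (f y) \<le> A1 * dist x y" for x y
    using le[of x y] by (cases "x = y") (auto simp: dist_norm field_simps)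
  ultimately show ?thesis by (intro lipschitz_onI)
qed

lemma admissible_growth:
  assumes "admissible_test_class \<Phi> A1 A2 A3" "f \<in> \<Phi>"
  shows "\<bar>f x\<bar> \<le> A2 + A1 * norm x"
proof -
  have "ereal \<bar>f 0\<bar> \<le> (SUP f\<in>\<Phi>. ereal \<bar>f 0\<bar>)"
    using assms(2) by (rule SUP_upper)
  then have "\<bar>f 0\<bar> \<le> A2"
    using assms(1) by (simp add: admissible_test_class_def flip: ereal_less_eq(3))
  moreover have "\<bar>f x - f 0\<bar> \<le> A1 * norm x"
    using lipschitz_onD[OF admissible_lipschitz[OF assms], of x 0] by (simp add: dist_norm)
  ultimately show ?thesis by linarith
qed

lemma admissible_borel:
  assumes "admissible_test_class \<Phi> A1 A2 A3" "f \<in> \<Phi>"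
  shows "f \<in> borel_measurable borel"
  using admissible_lipschitz[OF assms]
  by (intro borel_measurable_continuous_onI) (rule lipschitz_on_continuous_on)

text \<open>Test functions grow at most linearly and the first moment is finite. The bound on the
  integral is uniform in \<open>f\<close>, which later makes the supremum in \<open>ipm\<close>
  finite.\<close>

lemma admissible_integrable:
  assumes "admissible_test_class \<Phi> A1 A2 A3" "f \<in> \<Phi>" "\<mu> \<in> prob_measures1"
  shows "integrable \<mu> f" "\<bar>\<integral>x. f x \<partial>\<mu>\<bar> \<le> A2 + A1 * (\<integral>x. norm x \<partial>\<mu>)"
proof -
  note \<mu> = prob_measures1D[OF assms(3)]
  interpret prob_space \<mu> using prob_measuresD \<mu>(1) by blast
  have "f \<in> borel_measurable \<mu>"
    using admissible_borel[OF assms(1,2)] prob_measuresD(2)[OF \<mu>(1)]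
    by (simp cong: measurable_cong_sets)
  moreover have bound: "integrable \<mu> (\<lambda>x. A2 + A1 * norm x)"
    using \<mu>(2) by simp
  ultimately show int: "integrable \<mu> f"
    using admissible_growth[OF assms(1,2)]
    by (intro Bochner_Integration.integrable_bound[OF bound])
      (auto intro!: AE_I2 intro: order_trans[OF _ abs_ge_self])
  have "\<bar>\<integral>x. f x \<partial>\<mu>\<bar> \<le> (\<integral>x. \<bar>f x\<bar> \<partial>\<mu>)" by simp
  also have "\<dots> \<le> (\<integral>x. A2 + A1 * norm x \<partial>\<mu>)"
    using int bound admissible_growth[OF assms(1,2)] by (intro integral_mono) auto
  also have "\<dots> = A2 + A1 * (\<integral>x. norm x \<partial>\<mu>)"
    using \<mu>(2) by (simp add: prob_space)
  finally show "\<bar>\<integral>x. f x \<partial>\<mu>\<bar> \<le> A2 + A1 * (\<integral>x. norm x \<partial>\<mu>)" .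
qed

text \<open>Finiteness lets later estimates run in the reals. Over an empty class the supremum would
  be -\<infinity> in \<open>ereal\<close>.\<close>

lemma admissible_ipm:
  assumes "admissible_test_class \<Phi> A1 A2 A3" "\<Phi> \<noteq> {}" "\<mu> \<in> prob_measures1" "\<nu> \<in> prob_measures1"
  obtains D where "ipm \<Phi> \<mu> \<nu> = ereal D"
    and "\<And>f. f \<in> \<Phi> \<Longrightarrow> \<bar>(\<integral>x. f x \<partial>\<mu>) - (\<integral>x. f x \<partial>\<nu>)\<bar> \<le> D"
proof -
  have ge: "ereal \<bar>(\<integral>x. f x \<partial>\<mu>) - (\<integral>x. f x \<partial>\<nu>)\<bar> \<le> ipm \<Phi> \<mu> \<nu>" if "f \<in> \<Phi>" for f
    unfolding ipm_def using that by (rule SUP_upper)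
  have "ipm \<Phi> \<mu> \<nu> \<le> ereal ((A2 + A1 * (\<integral>x. norm x \<partial>\<mu>)) + (A2 + A1 * (\<integral>x. norm x \<partial>\<nu>)))"
    unfolding ipm_def
  proof (rule SUP_least)
    fix f assume "f \<in> \<Phi>"
    then show "ereal \<bar>(\<integral>x. f x \<partial>\<mu>) - (\<integral>x. f x \<partial>\<nu>)\<bar>
      \<le> ereal ((A2 + A1 * (\<integral>x. norm x \<partial>\<mu>)) + (A2 + A1 * (\<integral>x. norm x \<partial>\<nu>)))"
      using admissible_integrable(2)[OF assms(1) _ assms(3), of f]
        admissible_integrable(2)[OF assms(1) _ assms(4), of f]
      unfolding ereal_less_eq(3) by linarith
  qed
  moreover obtain f where "f \<in> \<Phi>" using assms(2) by blast
  ultimately obtain D where D: "ipm \<Phi> \<mu> \<nu> = ereal D"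
    using ge[of f] by (cases "ipm \<Phi> \<mu> \<nu>") auto
  show ?thesis using ge by (intro that[OF D]) (simp add: D)
qed

subsection \<open>Relative entropy and Pinsker's inequality\<close>

text \<open>Radon-Nikodym derivatives are unique up to null sets, so \<open>entropy_density\<close>
  equals \<open>g\<close> almost everywhere; integrability of \<open>g\<close> then selects the
  finite branch of \<open>relative_entropy\<close>.\<close>

lemma relative_entropy_exp_density:
  assumes "prob_space \<mu>'" and [measurable]: "g \<in> borel_measurable \<mu>'"
    and \<mu>: "\<mu> = density \<mu>' (\<lambda>x. ennreal (exp (g x)))" and int: "integrable \<mu> g"
  shows "relative_entropy \<mu> \<mu>' = ereal (\<integral>x. g x \<partial>\<mu>)"
proof -
  interpret prob_space \<mu>' by fact
  have "AE x in \<mu>'. ennreal (exp (g x)) = RN_deriv \<mu>' \<mu> x"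
    by (intro RN_deriv_unique) (auto simp: \<mu>)
  then have "AE x in \<mu>'. entropy_density (exp 1) \<mu>' \<mu> x = g x"
  proof (rule eventually_mono)
    fix x assume "ennreal (exp (g x)) = RN_deriv \<mu>' \<mu> x"
    then have "enn2real (RN_deriv \<mu>' \<mu> x) = exp (g x)"
      by (metis enn2real_ennreal exp_ge_zero)
    then show "entropy_density (exp 1) \<mu>' \<mu> x = g x"
      by (simp add: entropy_density_def log_def)
  qed
  moreover have ac: "absolutely_continuous \<mu>' \<mu>"
    unfolding \<mu> by (intro absolutely_continuousI_density) simp
  ultimately have ae: "AE x in \<mu>. entropy_density (exp 1) \<mu>' \<mu> x = g x"
    by (intro absolutely_continuous_AE[where M = \<mu>' and M' = \<mu>]) (auto simp: \<mu>)
  have meas: "entropy_density (exp 1) \<mu>' \<mu> \<in> borel_measurable \<mu>" "g \<in> borel_measurable \<mu>"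
    by (auto simp: \<mu>)
  moreover have "integrable \<mu> (entropy_density (exp 1) \<mu>' \<mu>)"
    using int integrable_cong_AE[OF meas ae] by simp
  moreover have "KL_divergence (exp 1) \<mu>' \<mu> = (\<integral>x. g x \<partial>\<mu>)"
    unfolding KL_divergence_def using meas ae by (rule integral_cong_AE)
  ultimately show ?thesis using ac by (simp add: relative_entropy_def)
qed

text \<open>The Donsker--Varadhan inequality for the function \<open>t\<close> times the indicator of \<open>A\<close>, with the
  logarithmic moment generating function estimated by Hoeffding's lemma and the optimal
  \<open>t = 4 (\<mu>(A) - \<mu>'(A))\<close>.\<close>

lemma pinsker_event_aux:
  assumes "prob_space \<mu>'" "prob_space \<mu>" and [measurable]: "g \<in> borel_measurable \<mu>'"
    and \<mu>: "\<mu> = density \<mu>' (\<lambda>x. ennreal (exp (g x)))" and int: "integrable \<mu> g"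
    and A[measurable]: "A \<in> sets \<mu>'" and le: "measure \<mu>' A \<le> measure \<mu> A"
  shows "2 * (measure \<mu> A - measure \<mu>' A)\<^sup>2 \<le> (\<integral>x. g x \<partial>\<mu>)"
proof -
  interpret M': prob_space \<mu>' by fact
  interpret M: prob_space \<mu> by fact
  define t where "t = 4 * (measure \<mu> A - measure \<mu>' A)"
  \<comment> \<open>\<open>Z\<close> is the \<open>\<mu>'\<close>-mean of
    \<open>exp (t * indicator A x)\<close>: the moment generating function at \<open>t\<close> of a
    Bernoulli variable with parameter \<open>measure \<mu>' A\<close>.\<close>
  define Z where "Z = 1 + measure \<mu>' A * (exp t - 1)"
  have t: "t \<ge> 0" using le by (simp add: t_def)
  then have Z: "Z > 0" unfolding Z_def by (intro add_pos_nonneg mult_nonneg_nonneg) auto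
  have split: "exp (t * indicator A x) = 1 + indicator A x * (exp t - 1)" for x
    by (auto simp: indicator_def)
  have iA: "integrable \<mu>' (indicator A :: _ \<Rightarrow> real)" "integrable \<mu> (indicator A :: _ \<Rightarrow> real)"
    using A by (auto simp: \<mu> M'.emeasure_eq_measure intro!: M.integrable_const_bound[where B=1, unfolded \<mu>])
  \<comment> \<open>Integrating against \<mu> brings in the density \<open>exp (g x)\<close>, which
    cancels \<open>exp (- g x)\<close> and leaves the integral defining \<open>Z\<close>.\<close>
  have eq: "exp (g x) *\<^sub>R exp (t * indicator A x - g x) = 1 + indicator A x * (exp t - 1)" for x
    by (simp add: split flip: exp_add)
  have "integrable \<mu> (\<lambda>x. exp (t * indicator A x - g x))"
    unfolding \<mu> by (subst integrable_density) (use iA in \<open>auto simp: eq simp del: real_scaleR_def\<close>)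
  moreover have "(\<integral>x. exp (t * indicator A x - g x) \<partial>\<mu>) = Z"
    unfolding \<mu> by (subst integral_density) (use iA A in \<open>auto simp: eq Z_def M'.prob_space simp del: real_scaleR_def\<close>)
  \<comment> \<open>This is Jensen's inequality by way of ln u \<le> u - 1, with u the exponential
    divided by \<open>Z\<close>. As u has \<mu>-mean 1, the right-hand integral is
    \<open>ln Z\<close>.\<close>
  moreover have "(\<integral>x. t * indicator A x - g x \<partial>\<mu>)
      \<le> (\<integral>x. exp (t * indicator A x - g x) / Z - 1 + ln Z \<partial>\<mu>)"
  proof (intro integral_mono)
    fix x
    have "ln (exp (t * indicator A x - g x) / Z) \<le> exp (t * indicator A x - g x) / Z - 1"
      using Z by (intro ln_le_minus_one) auto
    then show "t * indicator A x - g x \<le> exp (t * indicator A x - g x) / Z - 1 + ln Z"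
      using Z by (simp add: ln_div)
  qed (use calculation(1) iA int in auto)
  ultimately have "t * measure \<mu> A - (\<integral>x. g x \<partial>\<mu>) \<le> ln Z"
    using Z iA int A by (simp add: M.prob_space) (simp add: \<mu>)
  \<comment> \<open>With d the difference of the two measures of \<open>A\<close>, both bounds
    together give t d - t^2/8 as a lower bound for the integral of \<open>g\<close>; at t = 4 d this
    is 2 d^2.\<close>
  moreover have "- t * measure \<mu>' A + ln Z \<le> t\<^sup>2 / 8"
    unfolding Z_def using t by (intro Hoeffdings_lemma_aux) auto
  ultimately show ?thesis
    by (simp add: t_def power2_eq_square algebra_simps)
qed

text \<open>The one-sided version requires t \<ge> 0. Passing to the complement of \<open>A\<close>
  reverses the sign of the difference and keeps its square.\<close>

lemma pinsker_event:
  assumes "prob_space \<mu>'" "prob_space \<mu>" and g: "g \<in> borel_measurable \<mu>'"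
    and \<mu>: "\<mu> = density \<mu>' (\<lambda>x. ennreal (exp (g x)))" and int: "integrable \<mu> g"
    and A: "A \<in> sets \<mu>'"
  shows "2 * (measure \<mu> A - measure \<mu>' A)\<^sup>2 \<le> (\<integral>x. g x \<partial>\<mu>)"
proof (cases "measure \<mu>' A \<le> measure \<mu> A")
  case True
  then show ?thesis using pinsker_event_aux[OF assms] by simp
next
  case False
  interpret M': prob_space \<mu>' by fact
  interpret M: prob_space \<mu> by fact
  have "sets \<mu> = sets \<mu>'" "space \<mu> = space \<mu>'" by (simp_all add: \<mu>)
  then have "measure \<mu>' (space \<mu>' - A) = 1 - measure \<mu>' A" "measure \<mu> (space \<mu>' - A) = 1 - measure \<mu> A"
    using A M.prob_compl[of A] M'.prob_compl[of A] by auto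
  then show ?thesis
    using pinsker_event_aux[OF assms(1-5), of "space \<mu>' - A"] A False
    by (simp add: power2_commute)
qed

text \<open>The supremum in \<open>tv_dist\<close> is a real one, so it dominates its members only
  once the set is known to be bounded.\<close>

lemma measure_diff_le_tv_dist:
  assumes "prob_space \<mu>" "prob_space \<mu>'" "A \<in> sets borel"
  shows "\<bar>measure \<mu> A - measure \<mu>' A\<bar> \<le> tv_dist \<mu> \<mu>'"
proof -
  interpret M: prob_space \<mu> by fact
  interpret M': prob_space \<mu>' by fact
  have "\<bar>measure \<mu> A - measure \<mu>' A\<bar> \<le> 1" for A
    using M.prob_le_1[of A] M'.prob_le_1[of A] measure_nonneg[of \<mu> A] measure_nonneg[of \<mu>' A] by linarith
  then have "bdd_above ((\<lambda>A. \<bar>measure \<mu> A - measure \<mu>' A\<bar>) ` sets borel)"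
    by (intro bdd_aboveI2)
  then show ?thesis
    unfolding tv_dist_def using assms(3) by (intro cSUP_upper)
qed

lemma tv_dist_nonneg:
  assumes "prob_space \<mu>" "prob_space \<mu>'"
  shows "0 \<le> tv_dist \<mu> \<mu>'"
  using measure_diff_le_tv_dist[OF assms, of "{}"] by simp

lemma tv_dist_le:
  assumes "\<And>A. A \<in> sets borel \<Longrightarrow> \<bar>measure \<mu> A - measure \<mu>' A\<bar> \<le> c"
  shows "tv_dist \<mu> \<mu>' \<le> c"
  unfolding tv_dist_def using assms by (intro cSUP_least) auto

lemma pinsker:
  assumes "prob_space \<mu>'" "prob_space \<mu>" "g \<in> borel_measurable \<mu>'"
    and "\<mu> = density \<mu>' (\<lambda>x. ennreal (exp (g x)))" "integrable \<mu> g"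
    and borel: "sets \<mu>' = sets borel"
  shows "2 * (tv_dist \<mu> \<mu>')\<^sup>2 \<le> (\<integral>x. g x \<partial>\<mu>)"
proof -
  let ?H = "\<integral>x. g x \<partial>\<mu>"
  have le: "\<bar>measure \<mu> A - measure \<mu>' A\<bar> \<le> sqrt (?H / 2)" if "A \<in> sets borel" for A
    using pinsker_event[OF assms(1-5), of A] that borel by (intro real_le_rsqrt) auto
  then have "(tv_dist \<mu> \<mu>')\<^sup>2 \<le> (sqrt (?H / 2))\<^sup>2"
    using tv_dist_nonneg[OF assms(2,1)] by (intro power_mono tv_dist_le)
  \<comment> \<open>The empty event shows that the argument of the square root is nonnegative, so
    squaring recovers it.\<close>
  moreover have "0 \<le> ?H"
    using pinsker_event[OF assms(1-5), of "{}"] by simp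
  ultimately show ?thesis by simp
qed

subsection \<open>Total variation controls the Wasserstein distance\<close>

text \<open>The complement of the support is the union of all open null sets; by Lindelof countably
  many of them already cover it.\<close>

lemma AE_measure_support:
  fixes P :: "'a::second_countable_topology measure"
  assumes "sets P = sets borel"
  shows "AE x in P. x \<in> measure_support P"
proof -
  let ?\<F> = "{U. open U \<and> emeasure P U = 0}"
  obtain \<F> where \<F>: "\<F> \<subseteq> ?\<F>" "countable \<F>" "\<Union>\<F> = \<Union>?\<F>"
    using Lindelof[of ?\<F>] by auto
  have "AE x in P. \<forall>U\<in>\<F>. x \<notin> U"
  proof (subst AE_ball_countable[OF \<F>(2)], intro ballI)
    fix U assume "U \<in> \<F>"
    then have "U \<in> null_sets P" using \<F>(1) assms by (auto simp: null_sets_def)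
    then show "AE x in P. x \<notin> U" by (rule AE_not_in)
  qed
  moreover have "x \<in> measure_support P" if "\<forall>U\<in>\<F>. x \<notin> U" for x
  proof -
    have "x \<notin> \<Union>?\<F>" using that \<F>(3) by blast
    then show ?thesis by (auto simp: measure_support_def zero_less_iff_neq_zero)
  qed
  ultimately show ?thesis by (rule eventually_mono)
qed

text \<open>Only the excess mass \<open>t\<close> is moved, and almost surely both ends of the move
  lie in the support, hence at most its diameter apart.\<close>

lemma wasserstein1_le_split:
  fixes P :: "'a::euclidean_space measure" and m a b :: "'a \<Rightarrow> ennreal"
  assumes "prob_space P" and sets_P[measurable_cong]: "sets P = sets borel"
    and [measurable]: "m \<in> borel_measurable P" "a \<in> borel_measurable P" "b \<in> borel_measurable P"
    and t: "(\<integral>\<^sup>+x. a x \<partial>P) = t" "(\<integral>\<^sup>+x. b x \<partial>P) = t" "t \<noteq> \<infinity>"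
    and \<mu>: "\<mu> = density P (\<lambda>x. m x + a x)" and \<mu>': "\<mu>' = density P (\<lambda>x. m x + b x)"
    and S: "bounded (measure_support P)"
  shows "wasserstein1 \<mu> \<mu>' \<le> enn2ereal (t * ennreal (diameter (measure_support P)))"
proof -
  interpret prob_space P by fact
  interpret PP: pair_prob_space P P ..
  \<comment> \<open>the common part \<open>m\<close> stays on the diagonal; the excess \<open>a\<close> is sent independently to \<open>b / t\<close>\<close>
  obtain c where c[measurable]: "c \<in> borel_measurable P"
    and c1: "(\<integral>\<^sup>+y. c y \<partial>P) = 1" and tc: "AE y in P. t * c y = b y"
  proof (cases "t = 0")
    \<comment> \<open>Here \<open>b\<close> cannot be normalised, but it vanishes almost everywhere,
      so any density of mass 1 serves.\<close>
    case True
    then have "AE y in P. b y = 0"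
      using t(2) nn_integral_0_iff_AE[of b P] by simp
    then show ?thesis using True by (intro that[of "\<lambda>_. 1"]) (auto simp: emeasure_space_1)
  next
    case False
    then have inv: "t * inverse t = 1"
      using t(3) by (simp add: less_top flip: divide_ennreal_def)
    show ?thesis
    proof (rule that[of "\<lambda>y. inverse t * b y"])
      show "(\<integral>\<^sup>+y. inverse t * b y \<partial>P) = 1"
        using inv t(2) by (simp add: nn_integral_cmult mult.commute)
      show "AE y in P. t * (inverse t * b y) = b y"
        using inv by (simp flip: mult.assoc)
    qed simp
  qed
  define N where "N = count_space (UNIV :: bool set) \<Otimes>\<^sub>M (P \<Otimes>\<^sub>M P)"
  define h where "h z = (if fst z then m (fst (snd z)) else a (fst (snd z))) * c (snd (snd z))"
    for z :: "bool \<times> 'a \<times> 'a"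
  define T where "T z = (fst (snd z), if fst z then fst (snd z) else snd (snd z))"
    for z :: "bool \<times> 'a \<times> 'a"
  define \<pi> where "\<pi> = distr (density N h) (borel \<Otimes>\<^sub>M borel) T"
  have h[measurable]: "h \<in> borel_measurable N"
    unfolding h_def N_def by measurable
  have T[measurable]: "T \<in> N \<rightarrow>\<^sub>M borel \<Otimes>\<^sub>M borel"
    unfolding T_def N_def by measurable
  \<comment> \<open>Both marginals and the transport cost are instances of this formula.\<close>
  have int: "(\<integral>\<^sup>+z. \<phi> z \<partial>\<pi>) = (\<integral>\<^sup>+x. m x * \<phi> (x, x) + a x * (\<integral>\<^sup>+y. c y * \<phi> (x, y) \<partial>P) \<partial>P)"
    if [measurable]: "\<phi> \<in> borel_measurable (borel \<Otimes>\<^sub>M borel)" for \<phi>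
  proof -
    have "(\<integral>\<^sup>+z. \<phi> z \<partial>\<pi>) = (\<integral>\<^sup>+z. h z * \<phi> (T z) \<partial>N)"
      unfolding \<pi>_def by (simp add: nn_integral_distr nn_integral_density)
    also have "\<dots> = (\<integral>\<^sup>+s. \<integral>\<^sup>+z. h (s, z) * \<phi> (T (s, z)) \<partial>(P \<Otimes>\<^sub>M P) \<partial>count_space UNIV)"
      unfolding N_def by (subst PP.nn_integral_fst) (simp_all flip: N_def)
    also have "\<dots> = (\<integral>\<^sup>+z. m (fst z) * c (snd z) * \<phi> (fst z, fst z) \<partial>(P \<Otimes>\<^sub>M P))
        + (\<integral>\<^sup>+z. a (fst z) * c (snd z) * \<phi> (fst z, snd z) \<partial>(P \<Otimes>\<^sub>M P))"
      by (subst nn_integral_count_space_finite) (auto simp: UNIV_bool h_def T_def add.commute)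
    also have "\<dots> = (\<integral>\<^sup>+x. \<integral>\<^sup>+y. m x * \<phi> (x, x) * c y \<partial>P \<partial>P)
        + (\<integral>\<^sup>+x. \<integral>\<^sup>+y. a x * (c y * \<phi> (x, y)) \<partial>P \<partial>P)"
      by (subst (1 2) nn_integral_fst[symmetric]) (simp_all add: mult_ac)
    also have "\<dots> = (\<integral>\<^sup>+x. m x * \<phi> (x, x) \<partial>P) + (\<integral>\<^sup>+x. a x * (\<integral>\<^sup>+y. c y * \<phi> (x, y) \<partial>P) \<partial>P)"
      by (simp add: nn_integral_cmult c1)
    also have "\<dots> = (\<integral>\<^sup>+x. m x * \<phi> (x, x) + a x * (\<integral>\<^sup>+y. c y * \<phi> (x, y) \<partial>P) \<partial>P)"
      by (simp add: nn_integral_add)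
    finally show ?thesis .
  qed
  have em: "emeasure (distr \<pi> borel p) A = (\<integral>\<^sup>+z. indicator A (p z) \<partial>\<pi>)"
    if [measurable]: "p \<in> borel \<Otimes>\<^sub>M borel \<rightarrow>\<^sub>M borel" "A \<in> sets borel" for p and A :: "'a set"
  proof -
    have [measurable_cong]: "sets \<pi> = sets (borel \<Otimes>\<^sub>M borel)" by (simp add: \<pi>_def)
    show ?thesis by (simp add: nn_integral_distr flip: nn_integral_indicator)
  qed
  have "\<pi> \<in> couplings \<mu> \<mu>'"
    unfolding couplings_def
  proof (intro CollectI conjI)
    show "sets \<pi> = sets (borel \<Otimes>\<^sub>M borel)" by (simp add: \<pi>_def)
    show "distr \<pi> borel fst = \<mu>"
    proof (rule measure_eqI)
      fix A :: "'a set" assume "A \<in> sets (distr \<pi> borel fst)"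
      then have A[measurable]: "A \<in> sets borel" by simp
      have "emeasure (distr \<pi> borel fst) A
          = (\<integral>\<^sup>+x. m x * indicator A x + a x * (\<integral>\<^sup>+y. c y * indicator A x \<partial>P) \<partial>P)"
        by (simp add: em int)
      also have "\<dots> = (\<integral>\<^sup>+x. (m x + a x) * indicator A x \<partial>P)"
        by (simp add: nn_integral_multc c1 distrib_right)
      also have "\<dots> = emeasure \<mu> A"
        unfolding \<mu> by (subst emeasure_density) (simp_all add: sets_P)
      finally show "emeasure (distr \<pi> borel fst) A = emeasure \<mu> A" .
    qed (simp add: \<mu> sets_P)
    show "distr \<pi> borel snd = \<mu>'"
    proof (rule measure_eqI)
      fix A :: "'a set" assume "A \<in> sets (distr \<pi> borel snd)"
      then have A[measurable]: "A \<in> sets borel" by simp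
      have "emeasure (distr \<pi> borel snd) A
          = (\<integral>\<^sup>+x. m x * indicator A x + a x * (\<integral>\<^sup>+y. c y * indicator A y \<partial>P) \<partial>P)"
        by (simp add: em int)
      also have "\<dots> = (\<integral>\<^sup>+x. m x * indicator A x \<partial>P) + (\<integral>\<^sup>+y. t * c y * indicator A y \<partial>P)"
        by (simp add: nn_integral_add nn_integral_multc nn_integral_cmult t mult.assoc)
      also have "(\<integral>\<^sup>+y. t * c y * indicator A y \<partial>P) = (\<integral>\<^sup>+y. b y * indicator A y \<partial>P)"
        using tc by (intro nn_integral_cong_AE) auto
      also have "(\<integral>\<^sup>+x. m x * indicator A x \<partial>P) + \<dots> = (\<integral>\<^sup>+x. (m x + b x) * indicator A x \<partial>P)"
        by (simp add: nn_integral_add distrib_right)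
      also have "\<dots> = emeasure \<mu>' A"
        unfolding \<mu>' by (subst emeasure_density) (simp_all add: sets_P)
      finally show "emeasure (distr \<pi> borel snd) A = emeasure \<mu>' A" .
    qed (simp add: \<mu>' sets_P)
  qed
  then have "wasserstein1 \<mu> \<mu>' \<le> enn2ereal (\<integral>\<^sup>+(x, y). ennreal (norm (x - y)) \<partial>\<pi>)"
    unfolding wasserstein1_def by (rule INF_lower)
  also have "(\<integral>\<^sup>+(x, y). ennreal (norm (x - y)) \<partial>\<pi>)
      \<le> t * ennreal (diameter (measure_support P))"
  proof -
    let ?D = "ennreal (diameter (measure_support P))"
    note ae = AE_measure_support[OF sets_P]
    \<comment> \<open>The resting part costs nothing, since its two coordinates agree.\<close>
    have "(\<integral>\<^sup>+(x, y). ennreal (norm (x - y)) \<partial>\<pi>)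
        = (\<integral>\<^sup>+x. a x * (\<integral>\<^sup>+y. c y * ennreal (norm (x - y)) \<partial>P) \<partial>P)"
      by (subst int) auto
    also have "\<dots> \<le> (\<integral>\<^sup>+x. a x * ?D \<partial>P)"
    proof (intro nn_integral_mono_AE)
      show "AE x in P. a x * (\<integral>\<^sup>+y. c y * ennreal (norm (x - y)) \<partial>P) \<le> a x * ?D"
        using ae
      proof (rule eventually_mono)
        fix x assume x: "x \<in> measure_support P"
        have "(\<integral>\<^sup>+y. c y * ennreal (norm (x - y)) \<partial>P) \<le> (\<integral>\<^sup>+y. c y * ?D \<partial>P)"
        proof (intro nn_integral_mono_AE)
          show "AE y in P. c y * ennreal (norm (x - y)) \<le> c y * ?D"
            using ae by (rule eventually_mono)
              (use diameter_bounded_bound[OF S x] in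
                \<open>auto intro!: mult_left_mono ennreal_leI simp: dist_norm\<close>)
        qed
        also have "\<dots> = ?D" by (simp add: nn_integral_multc c1)
        finally show "a x * (\<integral>\<^sup>+y. c y * ennreal (norm (x - y)) \<partial>P) \<le> a x * ?D"
          by (rule mult_left_mono) simp
      qed
    qed
    also have "\<dots> = t * ?D" by (simp add: nn_integral_multc t)
    finally show ?thesis .
  qed
  finally show ?thesis by (simp add: less_eq_ennreal.rep_eq)
qed

text \<open>Split both densities into their minimum and the excesses \<open>a\<close> and
  \<open>b\<close>. The excess mass is the difference of the two measures on the set where
  \<open>f\<close> exceeds \<open>g\<close>, hence at most the total variation distance.\<close>

lemma wasserstein1_le_tv_dist:
  fixes P :: "'a::euclidean_space measure" and f g :: "'a \<Rightarrow> real"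
  assumes "prob_space P" and sets_P[measurable_cong]: "sets P = sets borel"
    and [measurable]: "f \<in> borel_measurable P" "g \<in> borel_measurable P"
    and \<mu>: "\<mu> = density P (\<lambda>x. ennreal (f x))" "prob_space \<mu>"
    and \<mu>': "\<mu>' = density P (\<lambda>x. ennreal (g x))" "prob_space \<mu>'"
    and S: "bounded (measure_support P)"
  shows "wasserstein1 \<mu> \<mu>' \<le> ereal (diameter (measure_support P) * tv_dist \<mu> \<mu>')"
proof -
  interpret M: prob_space \<mu> by fact
  interpret M': prob_space \<mu>' by fact
  \<comment> \<open>The truncation at 0 mirrors \<open>ennreal\<close>, so the splitting holds
    pointwise whatever the signs of \<open>f\<close> and \<open>g\<close>.\<close>
  let ?f = "\<lambda>x. max 0 (f x)" and ?g = "\<lambda>x. max 0 (g x)"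
  define m where "m x = ennreal (min (?f x) (?g x))" for x
  define a where "a x = ennreal (?f x - ?g x)" for x
  define b where "b x = ennreal (?g x - ?f x)" for x
  have [measurable]: "m \<in> borel_measurable P" "a \<in> borel_measurable P" "b \<in> borel_measurable P"
    unfolding m_def a_def b_def by measurable
  have ma: "ennreal (f x) = m x + a x" and mb: "ennreal (g x) = m x + b x" for x
    by (auto simp: m_def a_def b_def ennreal_neg max_def min_def simp flip: ennreal_plus)
  define t where "t = (\<integral>\<^sup>+x. a x \<partial>P)"
  have fin: "(\<integral>\<^sup>+x. m x \<partial>P) + t = 1" "(\<integral>\<^sup>+x. m x \<partial>P) + (\<integral>\<^sup>+x. b x \<partial>P) = 1"
    using M.emeasure_space_1 M'.emeasure_space_1
    by (simp_all add: \<mu>(1) \<mu>'(1) ma mb emeasure_density nn_integral_add t_def cong: nn_integral_cong_simp)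
  then have m_fin: "(\<integral>\<^sup>+x. m x \<partial>P) \<noteq> \<infinity>" and "t \<noteq> \<infinity>"
    by auto
  \<comment> \<open>Both measures have mass 1 and share the finite mass of \<open>m\<close>;
    cancelling it shows that the excesses have equal mass.\<close>
  from fin have "(\<integral>\<^sup>+x. m x \<partial>P) + (\<integral>\<^sup>+x. b x \<partial>P) = (\<integral>\<^sup>+x. m x \<partial>P) + t"
    by simp
  with m_fin have tb: "(\<integral>\<^sup>+x. b x \<partial>P) = t"
    by (simp only: ennreal_add_left_cancel) simp
  \<comment> \<open>On this set \<open>b\<close> vanishes, and off it \<open>a\<close>
    vanishes.\<close>
  define A where "A = {x. ?g x < ?f x}"
  have A: "A \<in> sets borel"
    unfolding A_def by measurable
  have "emeasure \<mu> A = (\<integral>\<^sup>+x. m x * indicator A x + a x \<partial>P)"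
    unfolding \<mu>(1) using A
    by (subst emeasure_density)
      (auto simp: ma sets_P A_def a_def indicator_def ennreal_neg intro!: nn_integral_cong)
  moreover have "emeasure \<mu>' A = (\<integral>\<^sup>+x. m x * indicator A x \<partial>P)"
    unfolding \<mu>'(1) using A
    by (subst emeasure_density)
      (auto simp: mb sets_P A_def b_def indicator_def ennreal_neg intro!: nn_integral_cong)
  ultimately have "emeasure \<mu> A = emeasure \<mu>' A + t"
    using A by (simp add: nn_integral_add t_def sets_P)
  moreover obtain \<delta> where \<delta>: "t = ennreal \<delta>" "0 \<le> \<delta>"
    using \<open>t \<noteq> \<infinity>\<close> by (cases t) auto
  ultimately have "\<delta> = measure \<mu> A - measure \<mu>' A"
    by (simp add: M.emeasure_eq_measure M'.emeasure_eq_measure flip: ennreal_plus)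
  then have "\<delta> \<le> tv_dist \<mu> \<mu>'"
    using measure_diff_le_tv_dist[OF \<mu>(2) \<mu>'(2) A] by linarith
  have "wasserstein1 \<mu> \<mu>' \<le> enn2ereal (t * ennreal (diameter (measure_support P)))"
    using \<mu>(1) \<mu>'(1) tb \<delta> S
    by (intro wasserstein1_le_split[of P m a b]) (auto simp: assms(1) sets_P t_def ma mb)
  also have "\<dots> = ereal (\<delta> * diameter (measure_support P))"
    using \<delta> diameter_ge_0[OF S] by (simp flip: ennreal_mult)
  also have "\<dots> \<le> ereal (diameter (measure_support P) * tv_dist \<mu> \<mu>')"
    using \<open>\<delta> \<le> _\<close> diameter_ge_0[OF S] by (simp add: mult.commute mult_right_mono)
  finally show ?thesis .
qed

lemma wasserstein1_square_le:
  assumes "wasserstein1 \<mu> \<mu>' \<le> ereal w"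
  shows "(wasserstein1 \<mu> \<mu>')\<^sup>2 \<le> ereal (w\<^sup>2)"
proof -
  have "0 \<le> wasserstein1 \<mu> \<mu>'"
    unfolding wasserstein1_def by (intro INF_greatest) simp
  with assms obtain v where "wasserstein1 \<mu> \<mu>' = ereal v" "0 \<le> v" "v \<le> w"
    by (cases "wasserstein1 \<mu> \<mu>'") auto
  then show ?thesis by (simp add: power_mono)
qed

subsection \<open>The bias potential model\<close>

lemma integral_exp_pos:
  assumes "prob_space P" "integrable P (\<lambda>x. exp (f x :: real))"
  shows "0 < (\<integral>x. exp (f x) \<partial>P)"
  using assms by (intro prob_space.expectation_greater) auto

text \<open>The reference measure \<open>P\<close> cancels in the quotient of the two Gibbs
  densities. The quotient is written as an exponential because the entropy and Pinsker lemmas take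
  densities of that form.\<close>

lemma bias_potential_density_ratio:
  fixes V V' :: "'a \<Rightarrow> real"
  assumes "prob_space P" and [measurable]: "V \<in> borel_measurable P" "V' \<in> borel_measurable P"
    and "has_bias_potential P V \<mu>" "has_bias_potential P V' \<mu>'"
  shows "\<mu> = density \<mu>' (\<lambda>x. ennreal (exp
    (V' x - V x + (ln (\<integral>y. exp (- V' y) \<partial>P) - ln (\<integral>y. exp (- V y) \<partial>P)))))"
proof -
  define Z where "Z = (\<integral>y. exp (- V y) \<partial>P)"
  define Z' where "Z' = (\<integral>y. exp (- V' y) \<partial>P)"
  have Z: "0 < Z" "0 < Z'"
    using assms(4,5) integral_exp_pos[OF assms(1)]
    by (auto simp: Z_def Z'_def has_bias_potential_def)
  have \<mu>: "\<mu> = density P (\<lambda>x. ennreal (exp (- V x) / Z))"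
    and \<mu>': "\<mu>' = density P (\<lambda>x. ennreal (exp (- V' x) / Z'))"
    using assms(4,5) by (auto simp: has_bias_potential_def is_RN_density_def Z_def Z'_def)
  have "exp (- V' x) / Z' * exp (V' x - V x + (ln Z' - ln Z)) = exp (- V x) / Z" for x
    using Z by (simp add: exp_add exp_diff exp_minus field_simps)
  then have eq: "ennreal (exp (- V' x) / Z') * ennreal (exp (V' x - V x + (ln Z' - ln Z)))
      = ennreal (exp (- V x) / Z)" for x
    using Z by (simp flip: ennreal_mult)
  show ?thesis
    unfolding \<mu>' Z_def[symmetric] Z'_def[symmetric]
    by (subst density_density_eq) (simp_all add: eq \<mu>)
qed

text \<open>The uniform linear growth bound estimates both terms of the loss by constants
  independent of \<open>V\<close>. The integral \<open>E\<close> is finite without a moment of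
  \<open>P\<close>, its integrand being at most \<open>exp (- A2)\<close>.\<close>

lemma Loss1_bounded_below:
  assumes adm: "admissible_test_class \<Phi> A1 A2 A3" and P: "P \<in> prob_measures"
    and \<nu>: "\<nu> \<in> prob_measures1"
  obtains c where "\<And>V. V \<in> \<Phi> \<Longrightarrow> ereal c \<le> Loss1 P \<nu> V"
proof -
  note P = prob_measuresD[OF P]
  interpret prob_space P by (rule P)
  define E where "E = (\<integral>x. exp (- (A2 + A1 * norm x)) \<partial>P)"
  define c where "c = - (A2 + A1 * (\<integral>x. norm x \<partial>\<nu>)) + ln E"
  have "ereal c \<le> Loss1 P \<nu> V" if V: "V \<in> \<Phi>" for V
  proof (cases "integrable P (\<lambda>x. exp (- V x))")
    case True
    have "0 \<le> A1" using lipschitz_on_nonneg[OF admissible_lipschitz[OF adm V]] .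
    moreover have "(\<lambda>x. exp (- (A2 + A1 * norm x))) \<in> borel_measurable P"
      using P(2) by (simp cong: measurable_cong_sets)
    ultimately have int: "integrable P (\<lambda>x. exp (- (A2 + A1 * norm x)))"
      by (intro integrable_const_bound[where B = "exp (- A2)"]) auto
    have "E \<le> (\<integral>x. exp (- V x) \<partial>P)"
      unfolding E_def using abs_le_D1[OF admissible_growth[OF adm V]]
      by (intro integral_mono int True) (simp add: algebra_simps)
    moreover have "0 < E"
      unfolding E_def by (intro integral_exp_pos int prob_space_axioms)
    ultimately have "ln E \<le> ln (\<integral>x. exp (- V x) \<partial>P)" by simp
    with admissible_integrable(2)[OF adm V \<nu>] True show ?thesis
      by (simp add: Loss1_def c_def)
  qed (simp add: Loss1_def)
  then show ?thesis by (rule that)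
qed

lemma bias_potential_estimate:
  fixes P :: "'a::euclidean_space measure"
  assumes adm: "admissible_test_class \<Phi> A1 A2 A3" and P: "P \<in> prob_measures"
    and \<mu>: "\<mu> \<in> prob_measures1" and \<nu>: "\<nu> \<in> prob_measures1" and \<mu>': "\<mu>' \<in> prob_measures"
    and Vs: "Vs \<in> \<Phi>" "has_bias_potential P Vs \<mu>" and V': "V' \<in> \<Phi>" "has_bias_potential P V' \<mu>'"
  defines "bound \<equiv> 2 * ipm \<Phi> \<mu> \<nu> + Loss1 P \<nu> V' - (INF V\<in>\<Phi>. Loss1 P \<nu> V)"
  shows "(INF V\<in>\<Phi>. Loss1 P \<nu> V) > -\<infinity>" "relative_entropy \<mu> \<mu>' \<le> bound"
    and "compact (measure_support P) \<Longrightarrow>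
      (wasserstein1 \<mu> \<mu>')\<^sup>2 \<le> ereal ((diameter (measure_support P))\<^sup>2 / 2) * bound"
proof -
  note Pp = prob_measuresD[OF P] and \<mu>p = prob_measuresD[OF prob_measures1D(1)[OF \<mu>]]
    and \<mu>'p = prob_measuresD[OF \<mu>']
  obtain c where c: "\<And>V. V \<in> \<Phi> \<Longrightarrow> ereal c \<le> Loss1 P \<nu> V"
    by (rule Loss1_bounded_below[OF adm P \<nu>]) blast
  then have inf: "ereal c \<le> (INF V\<in>\<Phi>. Loss1 P \<nu> V)" by (intro INF_greatest)
  then show "(INF V\<in>\<Phi>. Loss1 P \<nu> V) > -\<infinity>" by auto
  obtain D where D: "ipm \<Phi> \<mu> \<nu> = ereal D"
    "\<And>f. f \<in> \<Phi> \<Longrightarrow> \<bar>(\<integral>x. f x \<partial>\<mu>) - (\<integral>x. f x \<partial>\<nu>)\<bar> \<le> D"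
    by (rule admissible_ipm[OF adm _ \<mu> \<nu>]) (use V'(1) in auto)
  define l where "l V = ln (\<integral>x. exp (- V x) \<partial>P)" for V :: "'a \<Rightarrow> real"
  have L: "Loss1 P \<nu> Vs = ereal ((\<integral>x. Vs x \<partial>\<nu>) + l Vs)" "Loss1 P \<nu> V' = ereal ((\<integral>x. V' x \<partial>\<nu>) + l V')"
    using Vs V' by (auto simp: Loss1_def has_bias_potential_def l_def)
  have "(INF V\<in>\<Phi>. Loss1 P \<nu> V) \<le> ereal ((\<integral>x. Vs x \<partial>\<nu>) + l Vs)"
    unfolding L(1)[symmetric] using Vs(1) by (rule INF_lower)
  \<comment> \<open>The infimum lies between \<open>c\<close> and the finite loss of
    \<open>Vs\<close>, hence is real.\<close>
  with inf obtain I where I: "(INF V\<in>\<Phi>. Loss1 P \<nu> V) = ereal I" "I \<le> (\<integral>x. Vs x \<partial>\<nu>) + l Vs"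
    by (cases "INF V\<in>\<Phi>. Loss1 P \<nu> V") auto
  define g where "g x = V' x - Vs x + (l V' - l Vs)" for x
  have borel: "Vs \<in> borel_measurable borel" "V' \<in> borel_measurable borel"
    using admissible_borel[OF adm] Vs V' by auto
  then have "Vs \<in> borel_measurable P" "V' \<in> borel_measurable P"
    using Pp(2) by (simp_all cong: measurable_cong_sets)
  then have dens: "\<mu> = density \<mu>' (\<lambda>x. ennreal (exp (g x)))"
    unfolding g_def l_def using Vs(2) V'(2) Pp(1) by (intro bias_potential_density_ratio)
  have g: "g \<in> borel_measurable \<mu>'"
    unfolding g_def using borel \<mu>'p(2) by (simp cong: measurable_cong_sets)
  interpret M: prob_space \<mu> by (rule \<mu>p)
  note int = admissible_integrable(1)[OF adm V'(1) \<mu>] admissible_integrable(1)[OF adm Vs(1) \<mu>]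
  then have gint: "integrable \<mu> g"
    unfolding g_def by simp
  have H: "(\<integral>x. g x \<partial>\<mu>) = (\<integral>x. V' x \<partial>\<mu>) - (\<integral>x. Vs x \<partial>\<mu>) + (l V' - l Vs)"
    unfolding g_def using int by (simp add: M.prob_space)
  define B where "B = 2 * D + ((\<integral>x. V' x \<partial>\<nu>) + l V') - I"
  have "bound = ereal 2 * ereal D + ereal ((\<integral>x. V' x \<partial>\<nu>) + l V') - ereal I"
    by (simp add: bound_def D(1) L(2) I(1))
  then have B: "bound = ereal B"
    by (simp add: B_def)
  \<comment> \<open>Exchanging \<mu> for \<nu> under \<open>V'\<close> and under \<open>Vs\<close>
    costs \<open>D\<close> each, and the loss of \<open>Vs\<close> is at least
    \<open>I\<close>.\<close>
  have HB: "(\<integral>x. g x \<partial>\<mu>) \<le> B"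
    using H I(2) D(2)[OF V'(1)] D(2)[OF Vs(1)] unfolding B_def by linarith
  then show "relative_entropy \<mu> \<mu>' \<le> bound"
    using relative_entropy_exp_density[OF \<mu>'p(1) g dens gint] by (simp add: B)
  show "(wasserstein1 \<mu> \<mu>')\<^sup>2 \<le> ereal ((diameter (measure_support P))\<^sup>2 / 2) * bound"
    if "compact (measure_support P)"
  proof -
    let ?K = "diameter (measure_support P)"
    have "wasserstein1 \<mu> \<mu>' \<le> ereal (?K * tv_dist \<mu> \<mu>')"
      using Vs(2) V'(2) Pp \<mu>p(1) \<mu>'p(1) compact_imp_bounded[OF that]
      by (intro wasserstein1_le_tv_dist)
        (auto simp: has_bias_potential_def is_RN_density_def)
    then have "(wasserstein1 \<mu> \<mu>')\<^sup>2 \<le> ereal ((?K * tv_dist \<mu> \<mu>')\<^sup>2)"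
      by (rule wasserstein1_square_le)
    also have "(?K * tv_dist \<mu> \<mu>')\<^sup>2 \<le> ?K\<^sup>2 / 2 * B"
      using pinsker[OF \<mu>'p(1) \<mu>p(1) g dens gint \<mu>'p(2)] HB
        mult_left_mono[of "2 * (tv_dist \<mu> \<mu>')\<^sup>2" B "?K\<^sup>2 / 2"]
      by (simp add: power_mult_distrib)
    finally show ?thesis by (simp add: B)
  qed
qed

subsection \<open>The density model\<close>

text \<open>Total variation is bounded by the L1 distance of the densities, and L1 by L2 because
  \<open>P\<close> is a probability measure. The usual factor 1/2 in the first bound is given
  up.\<close>

lemma tv_dist_square_le_L2:
  fixes p q :: "'a::topological_space \<Rightarrow> real"
  assumes "prob_space P" and sets_P: "sets P = sets borel"
    and "is_RN_density P \<mu> p" "prob_space \<mu>" "is_RN_density P \<mu>' q" "prob_space \<mu>'"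
    and int2: "integrable P (\<lambda>x. (p x - q x)\<^sup>2)"
  shows "(tv_dist \<mu> \<mu>')\<^sup>2 \<le> (\<integral>x. (p x - q x)\<^sup>2 \<partial>P)"
proof -
  interpret prob_space P by fact
  interpret M: prob_space \<mu> by fact
  interpret M': prob_space \<mu>' by fact
  have [measurable]: "p \<in> borel_measurable P" "q \<in> borel_measurable P"
    and nn: "AE x in P. 0 \<le> p x" "AE x in P. 0 \<le> q x"
    and \<mu>: "\<mu> = density P (\<lambda>x. ennreal (p x))" and \<mu>': "\<mu>' = density P (\<lambda>x. ennreal (q x))"
    using assms(3,5) by (auto simp: is_RN_density_def)
  have pq: "integrable P p" "integrable P q"
    using M.integrable_const[of "1::real"] M'.integrable_const[of "1::real"]
      integrable_density[OF _ _ nn(1), of "\<lambda>_. 1::real"] integrable_density[OF _ _ nn(2), of "\<lambda>_. 1::real"]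
    by (simp_all flip: \<mu> \<mu>')
  have le: "\<bar>measure \<mu> A - measure \<mu>' A\<bar> \<le> (\<integral>x. \<bar>p x - q x\<bar> \<partial>P)" if "A \<in> sets borel" for A
  proof -
    have A: "A \<in> sets P" using that sets_P by simp
    have iA: "integrable P (\<lambda>x. p x * indicator A x)" "integrable P (\<lambda>x. q x * indicator A x)"
      using A pq by (auto intro: integrable_real_mult_indicator)
    have "measure \<mu> A = (\<integral>x. indicator A x \<partial>\<mu>)" "measure \<mu>' A = (\<integral>x. indicator A x \<partial>\<mu>')"
      using A by (simp_all add: \<mu> \<mu>')
    then have "measure \<mu> A = (\<integral>x. p x * indicator A x \<partial>P)" "measure \<mu>' A = (\<integral>x. q x * indicator A x \<partial>P)"
      using A integral_density[OF _ _ nn(1), of "indicator A :: _ \<Rightarrow> real"]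
        integral_density[OF _ _ nn(2), of "indicator A :: _ \<Rightarrow> real"]
      by (simp_all flip: \<mu> \<mu>')
    then have "\<bar>measure \<mu> A - measure \<mu>' A\<bar> = \<bar>\<integral>x. p x * indicator A x - q x * indicator A x \<partial>P\<bar>"
      using iA by simp
    also have "\<dots> \<le> (\<integral>x. \<bar>p x * indicator A x - q x * indicator A x\<bar> \<partial>P)" by simp
    also have "\<dots> \<le> (\<integral>x. \<bar>p x - q x\<bar> \<partial>P)"
      using iA pq by (intro integral_mono) (auto simp: indicator_def)
    finally show ?thesis .
  qed
  have "(tv_dist \<mu> \<mu>')\<^sup>2 \<le> (\<integral>x. \<bar>p x - q x\<bar> \<partial>P)\<^sup>2"
    using tv_dist_nonneg[OF assms(4,6)] le by (intro power_mono tv_dist_le)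
  \<comment> \<open>Cauchy-Schwarz in the form that the variance of |p - q| under \<open>P\<close>
    is nonnegative.\<close>
  also have "\<dots> \<le> (\<integral>x. (p x - q x)\<^sup>2 \<partial>P)"
    using variance_eq[of "\<lambda>x. \<bar>p x - q x\<bar>"] variance_positive[of "\<lambda>x. \<bar>p x - q x\<bar>"] pq int2
    by simp
  finally show ?thesis .
qed

lemma density_model_estimate:
  fixes P :: "'a::euclidean_space measure"
  assumes adm: "admissible_test_class \<Phi> A1 A2 A3" and P: "P \<in> prob_measures"
    and \<mu>: "\<mu> \<in> prob_measures1" and \<nu>: "\<nu> \<in> prob_measures1" and \<mu>': "\<mu>' \<in> prob_measures"
    and qs: "qs \<in> \<Phi>" "is_RN_density P \<mu> qs" and q': "q' \<in> \<Phi>" "is_RN_density P \<mu>' q'"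
  shows "(INF q\<in>\<Phi>. Loss2 P \<Phi> \<nu> q) \<le> ipm \<Phi> \<mu> \<nu>"
    and "ereal ((tv_dist \<mu> \<mu>')\<^sup>2) \<le> 2 * (ipm \<Phi> \<mu> \<nu> + Loss2 P \<Phi> \<nu> q')"
    and "compact (measure_support P) \<Longrightarrow>
      (wasserstein1 \<mu> \<mu>')\<^sup>2 \<le> ereal (2 * (diameter (measure_support P))\<^sup>2) *
        (ipm \<Phi> \<mu> \<nu> + Loss2 P \<Phi> \<nu> q')"
proof -
  note Pp = prob_measuresD[OF P] and \<mu>p = prob_measuresD[OF prob_measures1D(1)[OF \<mu>]]
    and \<mu>'p = prob_measuresD[OF \<mu>']
  have borel: "f \<in> borel_measurable P" if "f \<in> \<Phi>" for f
    using admissible_borel[OF adm that] Pp(2) by (simp cong: measurable_cong_sets)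
  have dens: "(\<integral>x. f x * q x \<partial>P) = (\<integral>x. f x \<partial>\<rho>)" "integrable \<rho> f \<Longrightarrow> integrable P (\<lambda>x. f x * q x)"
    if "f \<in> \<Phi>" "is_RN_density P \<rho> q" for f q \<rho>
    using that(2) borel[OF that(1)]
    by (auto simp: is_RN_density_def integral_density integrable_density mult.commute)
  have ints: "integrable P (\<lambda>x. f x * qs x)" if "f \<in> \<Phi>" for f
    using dens(2)[OF that qs(2)] admissible_integrable(1)[OF adm that \<mu>] .
  have "Loss2 P \<Phi> \<nu> qs = ipm \<Phi> \<mu> \<nu>"
    using ints dens(1)[OF _ qs(2)]
    by (auto simp: Loss2_def ipm_def abs_minus_commute intro!: SUP_cong)
  then show "(INF q\<in>\<Phi>. Loss2 P \<Phi> \<nu> q) \<le> ipm \<Phi> \<mu> \<nu>"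
    using INF_lower[OF qs(1), of "Loss2 P \<Phi> \<nu>"] by simp
  obtain D where D: "ipm \<Phi> \<mu> \<nu> = ereal D"
    "\<And>f. f \<in> \<Phi> \<Longrightarrow> \<bar>(\<integral>x. f x \<partial>\<mu>) - (\<integral>x. f x \<partial>\<nu>)\<bar> \<le> D"
    by (rule admissible_ipm[OF adm _ \<mu> \<nu>]) (use qs(1) in auto)
  have tv: "ereal ((tv_dist \<mu> \<mu>')\<^sup>2) \<le> ereal 2 * (ereal D + Loss2 P \<Phi> \<nu> q')"
  proof (cases "Loss2 P \<Phi> \<nu> q' = \<infinity>")
    case False
    \<comment> \<open>No first moment of \<mu>' is assumed, so integrability against
      \<open>q'\<close> has to come from the finite loss, which excludes the default branch of
      \<open>Loss2\<close>.\<close>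
    then have int': "integrable P (\<lambda>x. f x * q' x)" if "f \<in> \<Phi>" for f
      using that by (auto simp: Loss2_def split: if_splits)
    then have loss: "Loss2 P \<Phi> \<nu> q' = (SUP f\<in>\<Phi>. ereal \<bar>(\<integral>x. f x \<partial>\<nu>) - (\<integral>x. f x * q' x \<partial>P)\<bar>)"
      by (simp add: Loss2_def)
    have ge: "ereal \<bar>(\<integral>x. f x \<partial>\<nu>) - (\<integral>x. f x * q' x \<partial>P)\<bar> \<le> Loss2 P \<Phi> \<nu> q'" if "f \<in> \<Phi>" for f
      unfolding loss using that by (rule SUP_upper)
    then obtain L where L: "Loss2 P \<Phi> \<nu> q' = ereal L"
      using False qs(1) by (cases "Loss2 P \<Phi> \<nu> q'") force+
    have diff: "\<bar>(\<integral>x. f x * qs x \<partial>P) - (\<integral>x. f x * q' x \<partial>P)\<bar> \<le> D + L" if "f \<in> \<Phi>" for f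
      using D(2)[OF that] ge[OF that] dens(1)[OF that qs(2)] unfolding L ereal_less_eq(3) by linarith
    \<comment> \<open>Each product pairs a test function with a density. The first bracket tests the
      difference of the two measures with \<open>qs\<close>, the second with \<open>q'\<close>; by
      \<open>diff\<close> each contributes at most \<open>D + L\<close>.\<close>
    have sq: "(qs x - q' x)\<^sup>2 = (qs x * qs x - qs x * q' x) - (q' x * qs x - q' x * q' x)" for x
      by (simp add: power2_eq_square algebra_simps)
    have "integrable P (\<lambda>x. (qs x - q' x)\<^sup>2)"
      unfolding sq by (intro Bochner_Integration.integrable_diff ints int' qs(1) q'(1))
    then have "(tv_dist \<mu> \<mu>')\<^sup>2 \<le> (\<integral>x. (qs x - q' x)\<^sup>2 \<partial>P)"
      using Pp \<mu>p(1) \<mu>'p(1) qs(2) q'(2) by (intro tv_dist_square_le_L2)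
    also have "\<dots> = ((\<integral>x. qs x * qs x \<partial>P) - (\<integral>x. qs x * q' x \<partial>P))
        - ((\<integral>x. q' x * qs x \<partial>P) - (\<integral>x. q' x * q' x \<partial>P))"
      unfolding sq using ints int' qs(1) q'(1) by (simp add: mult.commute)
    also have "\<dots> \<le> 2 * (D + L)"
      using abs_le_D1[OF diff[OF qs(1)]] abs_le_D2[OF diff[OF q'(1)]] by simp
    finally show ?thesis by (simp add: L)
  qed simp
  then show "ereal ((tv_dist \<mu> \<mu>')\<^sup>2) \<le> 2 * (ipm \<Phi> \<mu> \<nu> + Loss2 P \<Phi> \<nu> q')"
    by (simp add: D(1))
  show "(wasserstein1 \<mu> \<mu>')\<^sup>2 \<le> ereal (2 * (diameter (measure_support P))\<^sup>2) *
      (ipm \<Phi> \<mu> \<nu> + Loss2 P \<Phi> \<nu> q')" if "compact (measure_support P)"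
  proof -
    let ?K = "diameter (measure_support P)"
    have "wasserstein1 \<mu> \<mu>' \<le> ereal (?K * tv_dist \<mu> \<mu>')"
      using qs(2) q'(2) Pp \<mu>p(1) \<mu>'p(1) compact_imp_bounded[OF that]
      by (intro wasserstein1_le_tv_dist) (auto simp: is_RN_density_def)
    then have "(wasserstein1 \<mu> \<mu>')\<^sup>2 \<le> ereal ((?K * tv_dist \<mu> \<mu>')\<^sup>2)"
      by (rule wasserstein1_square_le)
    also have "\<dots> = ereal (?K\<^sup>2) * ereal ((tv_dist \<mu> \<mu>')\<^sup>2)"
      by (simp add: power_mult_distrib)
    \<comment> \<open>The estimate stays in \<open>ereal\<close> because the loss may be infinite.
      If also the diameter is 0, the convention 0 * \<infinity> = 0 makes both sides 0.\<close>
    also have "\<dots> \<le> ereal (?K\<^sup>2) * (ereal 2 * (ereal D + Loss2 P \<Phi> \<nu> q'))"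
      using tv by (intro ereal_mult_left_mono) auto
    also have "\<dots> = (ereal (?K\<^sup>2) * ereal 2) * (ereal D + Loss2 P \<Phi> \<nu> q')"
      by (simp only: mult.assoc)
    finally show ?thesis by (simp add: D(1) mult.commute)
  qed
qed

theorem theorem2p8:
  fixes P :: "(real ^ 'd) measure"
    and \<Phi> :: "(real ^ 'd \<Rightarrow> real) set"
    and A1 A2 A3 :: real
  assumes "P \<in> prob_measures"
    and "admissible_test_class \<Phi> A1 A2 A3"
  shows
    "(\<forall>\<mu> \<in> prob_measures1. \<forall>\<nu> \<in> prob_measures1. \<forall>V' \<in> \<Phi>. \<forall>\<mu>' \<in> prob_measures.
        (\<exists>Vstar\<in>\<Phi>. has_bias_potential P Vstar \<mu>) \<longrightarrow> has_bias_potential P V' \<mu>' \<longrightarrow>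
          (INF V\<in>\<Phi>. Loss1 P \<nu> V) > -\<infinity> \<and>
          relative_entropy \<mu> \<mu>' \<le> 2 * ipm \<Phi> \<mu> \<nu> + Loss1 P \<nu> V' - (INF V\<in>\<Phi>. Loss1 P \<nu> V) \<and>
          (compact (measure_support P) \<longrightarrow>
             (wasserstein1 \<mu> \<mu>')\<^sup>2 \<le> ereal ((diameter (measure_support P))\<^sup>2 / 2) *
               (2 * ipm \<Phi> \<mu> \<nu> + Loss1 P \<nu> V' - (INF V\<in>\<Phi>. Loss1 P \<nu> V)))) \<and>
     (\<forall>\<mu> \<in> prob_measures1. \<forall>\<nu> \<in> prob_measures1. \<forall>q' \<in> \<Phi>. \<forall>\<mu>' \<in> prob_measures.
        (\<exists>qstar\<in>\<Phi>. is_RN_density P \<mu> qstar) \<longrightarrow> is_RN_density P \<mu>' q' \<longrightarrow>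
          (INF q\<in>\<Phi>. Loss2 P \<Phi> \<nu> q) \<le> ipm \<Phi> \<mu> \<nu> \<and>
          ereal ((tv_dist \<mu> \<mu>')\<^sup>2) \<le> 2 * (ipm \<Phi> \<mu> \<nu> + Loss2 P \<Phi> \<nu> q') \<and>
          (compact (measure_support P) \<longrightarrow>
             (wasserstein1 \<mu> \<mu>')\<^sup>2 \<le> ereal (2 * (diameter (measure_support P))\<^sup>2) *
               (ipm \<Phi> \<mu> \<nu> + Loss2 P \<Phi> \<nu> q')))"
proof (rule conjI; intro ballI impI; elim bexE)
  fix \<mu> \<nu> \<mu>' :: "(real ^ 'd) measure" and V' Vstar
  assume "\<mu> \<in> prob_measures1" "\<nu> \<in> prob_measures1" "V' \<in> \<Phi>" "\<mu>' \<in> prob_measures"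
    and "has_bias_potential P V' \<mu>'" "Vstar \<in> \<Phi>" "has_bias_potential P Vstar \<mu>"
  then show "(INF V\<in>\<Phi>. Loss1 P \<nu> V) > -\<infinity> \<and>
      relative_entropy \<mu> \<mu>' \<le> 2 * ipm \<Phi> \<mu> \<nu> + Loss1 P \<nu> V' - (INF V\<in>\<Phi>. Loss1 P \<nu> V) \<and>
      (compact (measure_support P) \<longrightarrow>
         (wasserstein1 \<mu> \<mu>')\<^sup>2 \<le> ereal ((diameter (measure_support P))\<^sup>2 / 2) *
           (2 * ipm \<Phi> \<mu> \<nu> + Loss1 P \<nu> V' - (INF V\<in>\<Phi>. Loss1 P \<nu> V)))"
    by (intro conjI impI bias_potential_estimate[OF assms(2,1)])
next
  fix \<mu> \<nu> \<mu>' :: "(real ^ 'd) measure" and q' qstar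
  assume "\<mu> \<in> prob_measures1" "\<nu> \<in> prob_measures1" "q' \<in> \<Phi>" "\<mu>' \<in> prob_measures"
    and "is_RN_density P \<mu>' q'" "qstar \<in> \<Phi>" "is_RN_density P \<mu> qstar"
  then show "(INF q\<in>\<Phi>. Loss2 P \<Phi> \<nu> q) \<le> ipm \<Phi> \<mu> \<nu> \<and>
      ereal ((tv_dist \<mu> \<mu>')\<^sup>2) \<le> 2 * (ipm \<Phi> \<mu> \<nu> + Loss2 P \<Phi> \<nu> q') \<and>
      (compact (measure_support P) \<longrightarrow>
         (wasserstein1 \<mu> \<mu>')\<^sup>2 \<le> ereal (2 * (diameter (measure_support P))\<^sup>2) *
           (ipm \<Phi> \<mu> \<nu> + Loss2 P \<Phi> \<nu> q'))"
    by (intro conjI impI density_model_estimate[OF assms(2,1)])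
qed

end
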